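(* Let $\mathbb{F}_q$ be a finite field with $q$ elements, let $d_1,d_2\ge 1$ be integers, let $P(X,Z)\in\mathbb{F}_q[X,Z]$ be monic in $Z$ with $\deg_Z P\ge 2$, and let $Q(X,Y,Z)\in\mathbb{F}_q[X,Y,Z]$ be monic in $Y$ with $\deg_Y Q\ge 2$. Let $$S_{d_1,d_2}(\mathbb{F}_q)=\{(\alpha,\beta,\gamma,\kappa)\in\mathbb{F}_q^4\mid \alpha^{d_1}\beta=P(\alpha,\gamma),\ \alpha^{d_2}\kappa=Q(\alpha,\beta,\gamma)\}$$ and $$N_0'=\#\{(\beta,\gamma)\in\mathbb{F}_q^2\mid P(0,\gamma)=0,\ Q(0,\beta,\gamma)=0\}.$$ Then $$|S_{d_1,d_2}(\mathbb{F}_q)|=q\bigl(q-1+N_0'\bigr).$$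
   Context: $S_{d_1,d_2}$ is the double Danielewski surface $X^{d_1}Y=P(X,Z)$, $X^{d_2}T=Q(X,Y,Z)$ in affine $4$-space, and $S_{d_1,d_2}(\mathbb{F}_q)$ is its set of $\mathbb{F}_q$-rational points. "Monic in $Z$" means leading coefficient $1$ as a polynomial in $Z$ over the polynomial ring in the other variables; similarly for $Y$. *)

theory Defs
  imports "HOL-Computational_Algebra.Polynomial"
begin

text \<open>
  Polynomials in several variables are iterated univariate ones:
  \<open>P(X,Z)\<close> is an element of $k[X][Z]$, and \<open>Q(X,Y,Z)\<close> is an element of $k[X][Z][Y]$, the
  outermost variable being the one in which the polynomial is required to be monic.
  Hence \<open>degree\<close> and \<open>lead_coeff\<close> refer to $Z$ for \<open>P\<close> and to $Y$ for \<open>Q\<close>.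
\<close>

definition eval_XZ :: "'a::comm_ring_1 poly poly \<Rightarrow> 'a \<Rightarrow> 'a \<Rightarrow> 'a" where
  "eval_XZ P x z = poly (map_poly (\<lambda>c. poly c x) P) z"

definition eval_XYZ :: "'a::comm_ring_1 poly poly poly \<Rightarrow> 'a \<Rightarrow> 'a \<Rightarrow> 'a \<Rightarrow> 'a" where
  "eval_XYZ Q x y z = poly (map_poly (\<lambda>c. eval_XZ c x z) Q) y"

text \<open>The coordinates of a point are listed in the order $(X,Y,Z,T)$.\<close>

definition double_danielewski_points ::
  "nat \<Rightarrow> nat \<Rightarrow> 'a::field poly poly \<Rightarrow> 'a poly poly poly \<Rightarrow> ('a \<times> 'a \<times> 'a \<times> 'a) set" where
  "double_danielewski_points d\<^sub>1 d\<^sub>2 P Q =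
     {(\<alpha>, \<beta>, \<gamma>, \<kappa>). \<alpha> ^ d\<^sub>1 * \<beta> = eval_XZ P \<alpha> \<gamma> \<and> \<alpha> ^ d\<^sub>2 * \<kappa> = eval_XYZ Q \<alpha> \<beta> \<gamma>}"

end

theory Submission imports Defs
begin

text \<open>Project the surface to its X-coordinate. Where it is nonzero, its powers are invertible,
  so X and Z may be chosen freely; the first equation then determines Y and the second T, giving
  \<open>(q - 1) * q\<close> points. Where it is zero, both left-hand sides vanish: the equations
  only constrain (Y, Z) to the set counted by \<open>N\<^sub>0'\<close>, and T is free, giving
  \<open>N\<^sub>0' * q\<close> points.\<close>

theorem corollary4p3:
  fixes P :: "'a::{field, finite} poly poly"
    and Q :: "'a poly poly poly"
    and d\<^sub>1 d\<^sub>2 q N\<^sub>0' :: nat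
  assumes q: "q = card (UNIV :: 'a set)"
    and d1: "d\<^sub>1 \<ge> 1"
    and d2: "d\<^sub>2 \<ge> 1"
    and P_monic: "lead_coeff P = 1"
    and P_degree: "degree P \<ge> 2"
    and Q_monic: "lead_coeff Q = 1"
    and Q_degree: "degree Q \<ge> 2"
    and N0: "N\<^sub>0' = card {(\<beta>, \<gamma>). eval_XZ P 0 \<gamma> = 0 \<and> eval_XYZ Q 0 \<beta> \<gamma> = 0}"
  shows "card (double_danielewski_points d\<^sub>1 d\<^sub>2 P Q) = q * (q - 1 + N\<^sub>0')"
proof -
  let ?S = "double_danielewski_points d\<^sub>1 d\<^sub>2 P Q"
  let ?N = "{(\<beta>, \<gamma>). eval_XZ P 0 \<gamma> = 0 \<and> eval_XYZ Q 0 \<beta> \<gamma> = 0}"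
  \<comment> \<open>\<open>y\<close> solves the first equation for Y over nonzero X.
    \<open>f\<close> substitutes that Y into Q and solves for T, so it parametrizes the part with X
    nonzero; \<open>g\<close> parametrizes the fibre X = 0.\<close>
  define y where "y = (\<lambda>x z. eval_XZ P x z / x ^ d\<^sub>1)"
  define f where "f = (\<lambda>(x, z). (x, y x z, z, eval_XYZ Q x (y x z) z / x ^ d\<^sub>2))"
  define g where "g = (\<lambda>((y, z), t). (0 :: 'a, y :: 'a, z :: 'a, t :: 'a))"
  \<comment> \<open>Positivity of the exponents enters here: with exponent 0 the power would be
    1.\<close>
  have zero_power: "(0 :: 'a) ^ d\<^sub>1 = 0" "(0 :: 'a) ^ d\<^sub>2 = 0"
    using d1 d2 by simp_all
  have S: "?S = f ` ((UNIV - {0}) \<times> UNIV) \<union> g ` (?N \<times> UNIV)"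
  proof (intro set_eqI iffI)
    fix p assume p: "p \<in> ?S"
    obtain a b c k where p_eq: "p = (a, b, c, k)" by (cases p)
    have eqs: "a ^ d\<^sub>1 * b = eval_XZ P a c" "a ^ d\<^sub>2 * k = eval_XYZ Q a b c"
      using p by (simp_all add: p_eq double_danielewski_points_def)
    show "p \<in> f ` ((UNIV - {0}) \<times> UNIV) \<union> g ` (?N \<times> UNIV)"
    proof (cases "a = 0")
      case True
      then have "p = g ((b, c), k)" "((b, c), k) \<in> ?N \<times> UNIV"
        using eqs by (simp_all add: p_eq g_def zero_power)
      then show ?thesis by blast
    next
      case False
      \<comment> \<open>Rewriting the value of P back to \<open>a ^ d\<^sub>1 * b\<close> lets the
        nonzero power cancel; likewise for Q below.\<close>
      have "b = y a c"
        using False by (simp add: y_def flip: eqs(1))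
      moreover have "k = eval_XYZ Q a b c / a ^ d\<^sub>2"
        using False by (simp flip: eqs(2))
      ultimately have "p = f (a, c)"
        by (simp add: p_eq f_def)
      then show ?thesis using False by blast
    qed
  next
    fix p assume "p \<in> f ` ((UNIV - {0}) \<times> UNIV) \<union> g ` (?N \<times> UNIV)"
    then show "p \<in> ?S"
      by (auto simp: double_danielewski_points_def f_def g_def y_def zero_power)
  qed
  have "card (f ` ((UNIV - {0}) \<times> UNIV)) = (q - 1) * q"
    \<comment> \<open>\<open>f\<close> is injective because its value retains both x and z.\<close>
    by (subst card_image) (auto simp: f_def inj_on_def card_cartesian_product card_Diff_singleton q)
  moreover have "card (g ` (?N \<times> UNIV)) = N\<^sub>0' * q"
    by (subst card_image) (auto simp: g_def inj_on_def card_cartesian_product q N0)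
  \<comment> \<open>The first coordinate is nonzero on one image and 0 on the other.\<close>
  moreover have "f ` ((UNIV - {0}) \<times> UNIV) \<inter> g ` (?N \<times> UNIV) = {}"
    by (auto simp: f_def g_def)
  ultimately have "card ?S = (q - 1) * q + N\<^sub>0' * q"
    unfolding S by (subst card_Un_disjoint) auto
  then show ?thesis by (simp add: algebra_simps)
qed

end
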